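(* Let $Q$ be the sequence-form polytope of a tree-form sequential decision process with set of decision points $\mathcal J$, action sets $A_j$, and set of sequences $\Sigma$. Define $\tilde\varphi,\varphi: Q\to\mathbb R$ by \[ \tilde\varphi(x) = w_\varnothing x_\varnothing\log x_\varnothing + \sum_{j\in\mathcal J}\sum_{a\in A_j} w_{ja}\,x_{ja}\log x_{ja} + \sum_{j\in\mathcal J}\gamma_j\, x_{p_j}\log|A_j|, \] \[ \varphi(x) = \gamma_\varnothing x_\varnothing\log x_\varnothing + \sum_{j\in\mathcal J}\gamma_j\Big(x_{p_j}\log|A_j| + \sum_{a\in A_j}x_{ja}\log\frac{x_{ja}}{x_{p_j}}\Big), \] where the weights are defined recursively by \[ \gamma_\varnothing = 1+\sum_{j\in\mathcal C_\varnothing}\gamma_j,\qquad \gamma_j = 1+\max_{a\in A_j}\Big\{\sum_{j'\in\mathcal C_{ja}}\gamma_{j'}\Big\}\ (j\in\mathcal J), \] \[ w_\varnothing = \gamma_\varnothing-\sum_{j\in\mathcal C_\varnothing}\gamma_j,\qquad w_{ja} = \gamma_j-\sum_{j'\in\mathcal C_{ja}}\gamma_{j'}\ (j\in\mathcal J,\ a\in A_j). \] Then $\tilde\varphi(x)=\varphi(x)$ for all $x\in Q$.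
   Context: Tree-form sequential decision process: a finite set $\mathcal J$ of decision points; each $j\in\mathcal J$ has a finite nonempty set of actions $A_j$. The set of sequences is $\Sigma=\{\varnothing\}\cup\{ja: j\in\mathcal J, a\in A_j\}$, where $\varnothing$ is a special element called the empty sequence. For each pair $ja$, $\mathcal C_{ja}\subset\mathcal J$ is the (possibly empty) set of next potential decision points after taking action $a$ at $j$; the decision points form a tree (forest), so $\mathcal C_{ja}\cap\mathcal C_{j'a'}=\emptyset$ whenever $ja\neq j'a'$. The parent sequence $p_j\in\Sigma$ of $j$ is the last sequence encountered on the path from the root to $j$ (so $p_{j'}=ja$ iff $j'\in\mathcal C_{ja}$), and $p_j=\varnothing$ if there is none; $\mathcal C_\varnothing=\{j\in\mathcal J: p_j=\varnothing\}$. The sequence-form polytope $Q$ is the set of all $x\in\mathbb R^{|\Sigma|}_{\ge0}$ with $x_\varnothing=1$ and $\sum_{a\in A_j}x_{ja}=x_{p_j}$ for all $j\in\mathcal J$. Conventions: $0\log 0=0\log(0/0)=0$. The function $\tilde\varphi$ is called the dilatable global entropy, and $\varphi$ is a dilated entropy function. *)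

theory Defs
  imports "HOL-Analysis.Analysis"
begin

datatype ('j, 'a) seqn = Root | Act 'j 'a

text \<open>
  \<open>C j a\<close> is the set of next potential decision points after taking action \<open>a\<close> at \<open>j\<close>.
  Values of \<open>A\<close> and \<open>C\<close> outside \<open>j \<in> J\<close> and \<open>a \<in> A j\<close> are junk and are never used.
  The decision points form a forest: every point has at most one parent sequence (\<open>C_disjoint\<close>)
  and the successor relation has no cycles (\<open>acyclic_succ\<close>).
\<close>

locale tfsdp =
  fixes J :: "'j set" and A :: "'j \<Rightarrow> 'a set" and C :: "'j \<Rightarrow> 'a \<Rightarrow> 'j set"
  assumes finite_J: "finite J"
    and finite_A: "j \<in> J \<Longrightarrow> finite (A j)"
    and A_nonempty: "j \<in> J \<Longrightarrow> A j \<noteq> {}"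
    and C_subset: "j \<in> J \<Longrightarrow> a \<in> A j \<Longrightarrow> C j a \<subseteq> J"
    and C_disjoint: "j \<in> J \<Longrightarrow> a \<in> A j \<Longrightarrow> j' \<in> J \<Longrightarrow> a' \<in> A j' \<Longrightarrow> (j, a) \<noteq> (j', a')
                      \<Longrightarrow> C j a \<inter> C j' a' = {}"
    and acyclic_succ: "acyclic {(j, j'). j \<in> J \<and> (\<exists>a\<in>A j. j' \<in> C j a)}"
begin

definition seqs :: "('j, 'a) seqn set" where
  "seqs = insert Root {Act j a | j a. j \<in> J \<and> a \<in> A j}"

definition parent :: "'j \<Rightarrow> ('j, 'a) seqn" where
  "parent j' =
    (if \<exists>j\<in>J. \<exists>a\<in>A j. j' \<in> C j a
     then THE s. \<exists>j\<in>J. \<exists>a\<in>A j. s = Act j a \<and> j' \<in> C j a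
     else Root)"

definition roots :: "'j set" where
  "roots = {j \<in> J. parent j = Root}"

text \<open>
  A vector indexed by the sequences is a function that is \<open>undefined\<close> off \<open>seqs\<close>, so that the
  polytope has one element per vector.
\<close>

definition Q :: "(('j, 'a) seqn \<Rightarrow> real) set" where
  "Q = {x \<in> seqs \<rightarrow>\<^sub>E {0..}. x Root = 1 \<and> (\<forall>j\<in>J. (\<Sum>a\<in>A j. x (Act j a)) = x (parent j))}"

lemma parent_eq_Act_iff:
  assumes "j \<in> J" "a \<in> A j"
  shows "parent j' = Act j a \<longleftrightarrow> j' \<in> C j a"
proof
  assume l: "parent j' = Act j a"
  then have "\<exists>j\<in>J. \<exists>a\<in>A j. j' \<in> C j a"
    by (auto simp: parent_def split: if_splits)
  then obtain i b where ib: "i \<in> J" "b \<in> A i" "j' \<in> C i b" by blast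
  have "(THE s. \<exists>j\<in>J. \<exists>a\<in>A j. s = Act j a \<and> j' \<in> C j a) = Act i b"
    by (rule the_equality) (use ib C_disjoint in blast)+
  with l ib show "j' \<in> C j a" by (auto simp: parent_def split: if_splits)
next
  assume r: "j' \<in> C j a"
  have "(THE s. \<exists>j\<in>J. \<exists>a\<in>A j. s = Act j a \<and> j' \<in> C j a) = Act j a"
    by (rule the_equality) (use r assms C_disjoint in blast)+
  with r assms show "parent j' = Act j a" by (auto simp: parent_def)
qed

lemma wf_succ: "wf {(j', j). j \<in> J \<and> (\<exists>a\<in>A j. j' \<in> C j a)}"
proof -
  let ?R = "{(j, j'). j \<in> J \<and> (\<exists>a\<in>A j. j' \<in> C j a)}"
  have "finite ?R"
    by (rule finite_subset[of _ "J \<times> J"]) (use C_subset finite_J in auto)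
  then have "wf (?R\<inverse>)" using acyclic_succ by (rule finite_acyclic_wf_converse)
  moreover have "?R\<inverse> = {(j', j). j \<in> J \<and> (\<exists>a\<in>A j. j' \<in> C j a)}" by auto
  ultimately show ?thesis by simp
qed

function gamma :: "'j \<Rightarrow> real" where
  "gamma j = (if j \<in> J then 1 + Max ((\<lambda>a. \<Sum>j'\<in>C j a. gamma j') ` A j) else 0)"
  by auto
termination
  by (relation "{(j', j). j \<in> J \<and> (\<exists>a\<in>A j. j' \<in> C j a)}") (auto intro: wf_succ)

declare gamma.simps [simp del]

definition gamma_root :: real where
  "gamma_root = 1 + (\<Sum>j\<in>roots. gamma j)"

fun w :: "('j, 'a) seqn \<Rightarrow> real" where
  "w Root = gamma_root - (\<Sum>j\<in>roots. gamma j)"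
| "w (Act j a) = gamma j - (\<Sum>j'\<in>C j a. gamma j')"

text \<open>
  The conventions \<open>0 log 0 = 0 log (0/0) = 0\<close> hold because multiplication by 0 gives 0 whatever
  \<^term>\<open>ln\<close> and division return. On \<^term>\<open>Q\<close>, a parent entry 0 forces all entries below it
  to be 0, so no other degenerate quotient occurs.
\<close>

definition dilatable_global_entropy :: "(('j, 'a) seqn \<Rightarrow> real) \<Rightarrow> real" where
  "dilatable_global_entropy x =
     w Root * x Root * ln (x Root)
     + (\<Sum>j\<in>J. \<Sum>a\<in>A j. w (Act j a) * x (Act j a) * ln (x (Act j a)))
     + (\<Sum>j\<in>J. gamma j * x (parent j) * ln (card (A j)))"

definition dilated_entropy :: "(('j, 'a) seqn \<Rightarrow> real) \<Rightarrow> real" where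
  "dilated_entropy x =
     gamma_root * x Root * ln (x Root)
     + (\<Sum>j\<in>J. gamma j *
          (x (parent j) * ln (card (A j))
           + (\<Sum>a\<in>A j. x (Act j a) * ln (x (Act j a) / x (parent j)))))"

end

end

theory Submission
  imports Defs
begin

text \<open>
  On \<open>Q\<close> the conditional term of \<open>\<phi>\<close> at \<open>j\<close> splits as
  \<open>(\<Sum>a. x\<^bsub>ja\<^esub> ln x\<^bsub>ja\<^esub>) - x\<^bsub>p\<^esub> ln x\<^bsub>p\<^esub>\<close> with \<open>p\<close> the parent of \<open>j\<close>, by the flow constraint. Grouping the
  subtracted terms by parent sequence, each \<open>x\<^bsub>s\<^esub> ln x\<^bsub>s\<^esub>\<close> receives the coefficient
  \<open>- (\<Sum>j\<in>C\<^bsub>s\<^esub>. \<gamma>\<^bsub>j\<^esub>)\<close>, which turns its weight \<open>\<gamma>\<close> into \<open>w\<close>.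
\<close>

context tfsdp
begin

text \<open>Makes the finite set \<open>seqs\<close> a valid index set for grouping sums over
  \<open>J\<close> by parent.\<close>

lemma parent_in_seqs: "parent j \<in> seqs"
proof (cases "\<exists>i\<in>J. \<exists>a\<in>A i. j \<in> C i a")
  case True
  then obtain i a where ia: "i \<in> J" "a \<in> A i" "j \<in> C i a" by blast
  then have "parent j = Act i a" by (simp add: parent_eq_Act_iff)
  with ia show ?thesis by (auto simp: seqs_def)
next
  case False
  then have "parent j = Root" unfolding parent_def by (rule if_not_P)
  then show ?thesis by (simp add: seqs_def)
qed

lemma seqs_eq: "seqs = insert Root ((\<lambda>(j, a). Act j a) ` (SIGMA j:J. A j))"
  by (auto simp: seqs_def)

lemma finite_seqs: "finite seqs"
  unfolding seqs_eq using finite_J finite_A by auto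

lemma sum_seqs:
  fixes h :: "('j, 'a) seqn \<Rightarrow> 'b::comm_monoid_add"
  shows "sum h seqs = h Root + (\<Sum>j\<in>J. \<Sum>a\<in>A j. h (Act j a))"
proof -
  have "sum h seqs = h Root + sum h ((\<lambda>(j, a). Act j a) ` (SIGMA j:J. A j))"
    unfolding seqs_eq using finite_J finite_A by (subst sum.insert) auto
  also have "sum h ((\<lambda>(j, a). Act j a) ` (SIGMA j:J. A j)) = (\<Sum>(j, a)\<in>(SIGMA j:J. A j). h (Act j a))"
    by (subst sum.reindex) (auto simp: inj_on_def intro!: sum.cong)
  also have "\<dots> = (\<Sum>j\<in>J. \<Sum>a\<in>A j. h (Act j a))"
    using finite_J finite_A by (subst sum.Sigma) auto
  finally show ?thesis .
qed

lemma C_eq_parent_fiber: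
  assumes "j \<in> J" "a \<in> A j"
  shows "C j a = {j' \<in> J. parent j' = Act j a}"
  using assms C_subset by (auto simp: parent_eq_Act_iff)

text \<open>The fibres of \<open>parent\<close> partition \<open>J\<close>: the fibre over
  \<open>Root\<close> is \<open>roots\<close>, the one over \<open>Act j a\<close> is
  \<open>C j a\<close>, and \<open>g (parent j)\<close> is constant on each.\<close>

lemma sum_by_parent:
  fixes f :: "'j \<Rightarrow> 'b::semiring_0" and g :: "('j, 'a) seqn \<Rightarrow> 'b"
  shows "(\<Sum>j\<in>J. f j * g (parent j)) =
    (\<Sum>j\<in>roots. f j) * g Root + (\<Sum>j\<in>J. \<Sum>a\<in>A j. (\<Sum>j'\<in>C j a. f j') * g (Act j a))"
proof -
  have "(\<Sum>j\<in>J. f j * g (parent j)) =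
      (\<Sum>s\<in>seqs. \<Sum>j\<in>{j \<in> J. parent j = s}. f j * g (parent j))"
    by (rule sum.group [symmetric]) (use finite_J finite_seqs parent_in_seqs in auto)
  also have "\<dots> = (\<Sum>s\<in>seqs. (\<Sum>j\<in>{j \<in> J. parent j = s}. f j) * g s)"
    by (auto simp: sum_distrib_right intro!: sum.cong)
  also have "\<dots> = (\<Sum>j\<in>roots. f j) * g Root
      + (\<Sum>j\<in>J. \<Sum>a\<in>A j. (\<Sum>j'\<in>C j a. f j') * g (Act j a))"
    by (simp add: sum_seqs roots_def C_eq_parent_fiber)
  finally show ?thesis .
qed

lemma sum_conditional_entropy:
  assumes x: "x \<in> Q" and j: "j \<in> J"
  shows "(\<Sum>a\<in>A j. x (Act j a) * ln (x (Act j a) / x (parent j))) =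
    (\<Sum>a\<in>A j. x (Act j a) * ln (x (Act j a))) - x (parent j) * ln (x (parent j))"
proof -
  have flow: "(\<Sum>a\<in>A j. x (Act j a)) = x (parent j)"
    using x j by (auto simp: Q_def)
  have nonneg: "0 \<le> x (Act j a)" if "a \<in> A j" for a
    using x j that by (auto simp: Q_def seqs_def PiE_iff)
  have "x (Act j a) * ln (x (Act j a) / x (parent j)) =
      x (Act j a) * ln (x (Act j a)) - x (Act j a) * ln (x (parent j))" if a: "a \<in> A j" for a
  \<comment> \<open>A zero entry makes every term vanish, whatever value \<open>ln\<close> takes
    there.\<close>
  proof (cases "x (Act j a) = 0")
    case False
    with nonneg [OF a] have pos: "0 < x (Act j a)" by simp
    \<comment> \<open>By the flow constraint the parent entry dominates each child entry, so it is
      positive too and the logarithm of the quotient splits.\<close>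
    also have "x (Act j a) \<le> x (parent j)"
      unfolding flow [symmetric] using a finite_A [OF j] nonneg by (intro member_le_sum) auto
    finally show ?thesis using pos by (simp add: ln_div right_diff_distrib)
  qed simp
  then have "(\<Sum>a\<in>A j. x (Act j a) * ln (x (Act j a) / x (parent j))) =
      (\<Sum>a\<in>A j. x (Act j a) * ln (x (Act j a))) - (\<Sum>a\<in>A j. x (Act j a)) * ln (x (parent j))"
    by (simp add: sum_subtractf sum_distrib_right)
  then show ?thesis by (simp add: flow)
qed

lemma dilatable_global_entropy_eq_dilated_entropy:
  assumes x: "x \<in> Q"
  shows "dilatable_global_entropy x = dilated_entropy x"
proof -
  \<comment> \<open>Keeping \<open>e\<close> opaque gives the subtracted sum the shape
    \<open>f j * g (parent j)\<close> needed for regrouping.\<close>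
  define e where "e s = x s * ln (x s)" for s
  have "dilated_entropy x = gamma_root * e Root + (\<Sum>j\<in>J. gamma j * x (parent j) * ln (card (A j)))
      + (\<Sum>j\<in>J. \<Sum>a\<in>A j. gamma j * e (Act j a)) - (\<Sum>j\<in>J. gamma j * e (parent j))"
    unfolding dilated_entropy_def e_def
    by (simp add: sum_conditional_entropy [OF x] algebra_simps sum.distrib sum_subtractf
        sum_distrib_left cong: sum.cong)
  also have "\<dots> = dilatable_global_entropy x"
    \<comment> \<open>With \<open>gamma\<close> for \<open>f\<close> and \<open>e\<close> for
      \<open>g\<close>, the coefficients become those in the equations of \<open>w\<close>.\<close>
    unfolding dilatable_global_entropy_def sum_by_parent
    by (simp add: e_def algebra_simps sum_subtractf)
  finally show ?thesis by simp
qed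

end

theorem theorem3:
  fixes J :: "'j set" and A :: "'j \<Rightarrow> 'a set" and C :: "'j \<Rightarrow> 'a \<Rightarrow> 'j set"
  assumes "tfsdp J A C"
  shows "\<forall>x \<in> tfsdp.Q J A C.
           tfsdp.dilatable_global_entropy J A C x = tfsdp.dilated_entropy J A C x"
  using tfsdp.dilatable_global_entropy_eq_dilated_entropy [OF assms] by blast

end
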